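(* For every $a\in\mathbb{C}$ with $\tfrac32-2a\notin\{0,-1,-2,\dots\}$, $$F\!\left(1-2a,\tfrac32-3a;\tfrac32-2a;\tfrac14\right)=\frac{2^{7/2-6a}\,\Gamma(\tfrac54-a)\,\Gamma(\tfrac34-a)}{3^{2-3a}\,\Gamma(\tfrac76-a)\,\Gamma(\tfrac56-a)}.$$
   Context: $F(a,b;c;x)=\sum_{n\ge0}\frac{(a,n)(b,n)}{(c,n)(1,n)}x^n$ with $(\alpha,n)=\Gamma(\alpha+n)/\Gamma(\alpha)$ is the Gauss hypergeometric series. $1/\Gamma$ is interpreted as $0$ at the poles of $\Gamma$. *)

theory Defs
  imports "HOL-Analysis.Analysis"
begin

text \<open>
  The symbol $(\alpha,n) = \Gamma(\alpha+n)/\Gamma(\alpha)$ is \<^const>\<open>pochhammer\<close>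
  (see \<open>pochhammer_Gamma\<close>). If $\alpha$ is a nonpositive integer, the quotient has to be read
  as its limit value $\alpha(\alpha+1)\cdots(\alpha+n-1)$, which is again \<^const>\<open>pochhammer\<close>.
\<close>

definition hypergeo_F :: "complex \<Rightarrow> complex \<Rightarrow> complex \<Rightarrow> complex \<Rightarrow> complex" where
  "hypergeo_F a b c x =
     (\<Sum>n. (pochhammer a n * pochhammer b n) / (pochhammer c n * pochhammer 1 n) * x ^ n)"

text \<open>
  \<^const>\<open>suminf\<close> is only meaningful for convergent series; the following lemma shows that the
  value of \<open>hypergeo_F\<close> is a genuine sum throughout the unit disc.
\<close>

lemma summable_hypergeo_F:
  fixes a b c x :: complex
  assumes x: "norm x < 1"
  shows "summable (\<lambda>n. (pochhammer a n * pochhammer b n) / (pochhammer c n * pochhammer 1 n) * x ^ n)"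
    (is "summable ?f")
proof -
  define q :: "nat \<Rightarrow> complex"
    where "q n = (a + of_nat n) * (b + of_nat n) / ((c + of_nat n) * (1 + of_nat n)) * x" for n
  have step: "?f (Suc n) = q n * ?f n" for n
    by (simp add: q_def pochhammer_Suc mult_ac)
  have shift: "(\<lambda>n. (d + of_nat n) / of_nat n) \<longlonglongrightarrow> 1" for d :: complex
  proof -
    have "(\<lambda>n. d / of_nat n + 1) \<longlonglongrightarrow> 0 + 1"
      by (intro tendsto_intros lim_const_over_n)
    moreover have "\<forall>\<^sub>F n in sequentially. d / of_nat n + 1 = (d + of_nat n) / of_nat n"
      using eventually_gt_at_top[of 0] by eventually_elim (simp add: field_simps)
    ultimately show ?thesis
      by (simp add: tendsto_cong)
  qed
  have "(\<lambda>n. ((a + of_nat n) / of_nat n) * ((b + of_nat n) / of_nat n) /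
             (((c + of_nat n) / of_nat n) * ((1 + of_nat n) / of_nat n)) * x)
          \<longlonglongrightarrow> 1 * 1 / (1 * 1) * x"
    by (intro tendsto_intros shift) auto
  moreover have "\<forall>\<^sub>F n in sequentially.
      ((a + of_nat n) / of_nat n) * ((b + of_nat n) / of_nat n) /
      (((c + of_nat n) / of_nat n) * ((1 + of_nat n) / of_nat n)) * x = q n"
    using eventually_gt_at_top[of 0] by eventually_elim (simp add: q_def)
  ultimately have "q \<longlonglongrightarrow> x"
    by (simp add: tendsto_cong)
  then have lim: "(\<lambda>n. norm (q n)) \<longlonglongrightarrow> norm x"
    by (rule tendsto_norm)
  obtain r where r: "norm x < r" "r < 1"
    using x dense by blast
  have "\<forall>\<^sub>F n in sequentially. norm (q n) < r"
    using lim r(1) by (rule order_tendstoD(2))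
  then obtain N where N: "\<And>n. n \<ge> N \<Longrightarrow> norm (q n) < r"
    by (auto simp: eventually_sequentially)
  show ?thesis
  proof (rule summable_ratio_test)
    show "r < 1" by (rule r(2))
    show "norm (?f (Suc n)) \<le> r * norm (?f n)" if "n \<ge> N" for n
      unfolding step norm_mult[of "q n"]
      using N[OF that] by (intro mult_right_mono) auto
  qed
qed

end

theory Submission
  imports Defs
begin

text \<open>
  Two Pfaff transformations, \<open>1/4 \<mapsto> -1/3 \<mapsto> 1/4\<close>, combine to Euler's transformation and
  turn the left-hand side into an elementary factor times
  \<open>E(a) = F(1/2, a; 3/2 - 2a; 1/4)\<close> (lemma \<open>Pfaff\<close>).

  The advantage of \<open>E\<close> is twofold. Firstly, \<open>E(a)\<close> and \<open>E(a - 1)\<close> are proportional. In general a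
  Gauss function is related to its contiguous functions only by three-term relations, but at the
  argument \<open>1/4\<close> one of the coefficients vanishes, and what remains is
  \<open>(5/4 - a) (3/4 - a) E(a) = (7/6 - a) (5/6 - a) E(a - 1)\<close>. It is proved by summing the series
  termwise: the difference of both sides telescopes (\<open>euler_telescope\<close>).
  Secondly, \<open>E(a - N)\<close> has an easily computed limit as \<open>N \<rightarrow> \<infinity>\<close>: the quotient
  \<open>(a - N, k) / (3/2 - 2a + 2N, k)\<close> tends to \<open>(-1/2)^k\<close>, so the series tends to the binomial series
  for \<open>(1 + 1/8)^(-1/2)\<close> (\<open>euler_limit\<close>).

  Iterating the recurrence \<open>N\<close> times expresses \<open>E(a)\<close> by \<open>E(a - N)\<close> and a quotient of Pochhammer
  symbols. Because of \<open>7/6 + 5/6 = 5/4 + 3/4\<close>, Euler's limit for the Gamma function, applied to each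
  of the four symbols, shows that this quotient converges to the desired product of Gamma values
  (\<open>pochhammer_quotient_tendsto\<close>). Neither step divides by anything that can vanish when
  \<open>3/2 - 2a\<close> is not a pole of the Gamma function, so that no exceptional values of \<open>a\<close> remain.
\<close>

section \<open>Pfaff's transformation\<close>

lemma neg_binomial_sums:
  fixes b x :: complex
  assumes "norm x < 1"
  shows "(\<lambda>n. pochhammer b n / fact n * x ^ n) sums (1 - x) powr (- b)"
proof -
  have "(\<lambda>n. (- b gchoose n) * (- x) ^ n) sums (1 + (- x)) powr (- b)"
    by (rule gen_binomial_complex) (use assms in auto)
  also have "(\<lambda>n. (- b gchoose n) * (- x) ^ n) = (\<lambda>n. pochhammer b n / fact n * x ^ n)"
    by (rule ext) (simp add: gbinomial_pochhammer power_minus[of x] mult_ac)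
  finally show ?thesis by simp
qed

lemma neg_binomial_sums_real:
  fixes b x :: real
  assumes "\<bar>x\<bar> < 1"
  shows "(\<lambda>n. pochhammer b n / fact n * x ^ n) sums (1 - x) powr (- b)"
proof -
  have "(\<lambda>n. (- b gchoose n) * (- x) ^ n) sums (1 + (- x)) powr (- b)"
    by (rule gen_binomial_real) (use assms in auto)
  also have "(\<lambda>n. (- b gchoose n) * (- x) ^ n) = (\<lambda>n. pochhammer b n / fact n * x ^ n)"
    by (rule ext) (simp add: gbinomial_pochhammer power_minus[of x] mult_ac)
  finally show ?thesis by simp
qed

lemma norm_pochhammer_le:
  fixes b :: complex
  assumes "norm b \<le> \<beta>"
  shows "norm (pochhammer b n) \<le> pochhammer \<beta> n"
  unfolding pochhammer_prod prod_norm[symmetric]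
proof (intro prod_mono conjI)
  fix i
  show "norm (b + of_nat i) \<le> \<beta> + of_nat i"
    using norm_triangle_ineq[of b "of_nat i"] assms by simp
qed simp

lemma summable_norm_hypergeo_F:
  fixes a b c x :: complex
  assumes "norm x < 1"
  shows "summable (\<lambda>n. norm (pochhammer a n * pochhammer b n / (pochhammer c n * pochhammer 1 n) * x ^ n))"
proof -
  obtain r where r: "norm x < r" "r < 1"
    using assms dense by blast
  then have "r > 0"
    using norm_ge_zero[of x] by linarith
  with r show ?thesis
    by (intro powser_insidea[OF summable_hypergeo_F[of "of_real r"]]) auto
qed

lemma pochhammer_neq_0:
  assumes "(c :: complex) \<notin> \<int>\<^sub>\<le>\<^sub>0"
  shows "pochhammer c n \<noteq> 0"
  using assms pochhammer_eq_0_imp_nonpos_Int by blast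

text \<open>
  The Chu--Vandermonde identity in the form in which it equates the coefficients of \<open>x^n\<close> on both
  sides of Pfaff's transformation. The usual form has \<open>(-n, k)\<close> in place of
  \<open>(-1)^k / fact (n - k)\<close>; the two agree up to the factor \<open>fact n\<close>.
\<close>

lemma Chu_Vandermonde_coeff:
  fixes a b c :: complex
  assumes c: "c \<notin> \<int>\<^sub>\<le>\<^sub>0"
  shows "(\<Sum>k\<le>n. pochhammer (c - a) k * pochhammer b k / (pochhammer c k * pochhammer 1 k) * (- 1) ^ k *
              (pochhammer (b + of_nat k) (n - k) / fact (n - k))) =
         pochhammer a n * pochhammer b n / (pochhammer c n * pochhammer 1 n)"
proof -
  have summand: "pochhammer (c - a) k * pochhammer b k / (pochhammer c k * pochhammer 1 k) * (- 1) ^ k *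
            (pochhammer (b + of_nat k) (n - k) / fact (n - k)) =
          pochhammer b n / fact n * (pochhammer (c - a) k * pochhammer (- of_nat n) k /
            (of_nat (fact k) * pochhammer c k))" if "k \<le> n" for k
  proof -
    have b: "pochhammer b n = pochhammer b k * pochhammer (b + of_nat k) (n - k)"
      by (rule pochhammer_product[OF that])
    have "(fact n :: complex) / fact (n - k) = (- 1) ^ k * pochhammer (- of_nat n) k"
    proof -
      have "(fact n :: complex) = fact (n - k) * pochhammer (1 + of_nat (n - k)) k"
        using pochhammer_product[of "n - k" n "1 :: complex"] that by (simp add: pochhammer_fact)
      moreover have "pochhammer (- of_nat n :: complex) k
                       = (- 1) ^ k * pochhammer (1 + of_nat (n - k)) k"
        using that by (simp add: pochhammer_minus of_nat_diff algebra_simps)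
      ultimately show ?thesis
        by simp
    qed
    moreover have "(1 :: complex) / fact (n - k) = (fact n / fact (n - k)) / fact n"
      by simp
    ultimately have f: "(1 :: complex) / fact (n - k) = (- 1) ^ k * pochhammer (- of_nat n) k / fact n"
      by (simp only:)
    have "pochhammer (c - a) k * pochhammer b k / (pochhammer c k * pochhammer 1 k) * (- 1) ^ k *
            (pochhammer (b + of_nat k) (n - k) / fact (n - k)) =
          pochhammer b n * pochhammer (c - a) k / (pochhammer c k * fact k) * (- 1) ^ k * (1 / fact (n - k))"
      by (simp add: b pochhammer_fact)
    also have "\<dots> = pochhammer b n / fact n * (pochhammer (c - a) k * pochhammer (- of_nat n) k /
            (of_nat (fact k) * pochhammer c k))"
      unfolding f by (simp add: mult_ac)
    finally show ?thesis .
  qed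
  have "\<forall>i\<in>{0..<n}. c \<noteq> - of_nat i"
    using c by auto
  from Vandermonde_pochhammer[OF this, of "c - a"]
  have V: "(\<Sum>k\<le>n. pochhammer (c - a) k * pochhammer (- of_nat n) k / (of_nat (fact k) * pochhammer c k))
             = pochhammer a n / pochhammer c n"
    by (simp add: atLeast0AtMost)
  have "(\<Sum>k\<le>n. pochhammer (c - a) k * pochhammer b k / (pochhammer c k * pochhammer 1 k) * (- 1) ^ k *
              (pochhammer (b + of_nat k) (n - k) / fact (n - k))) =
        pochhammer b n / fact n * (\<Sum>k\<le>n. pochhammer (c - a) k * pochhammer (- of_nat n) k /
            (of_nat (fact k) * pochhammer c k))"
    unfolding sum_distrib_left by (intro sum.cong refl summand) simp
  also have "\<dots> = pochhammer a n * pochhammer b n / (pochhammer c n * pochhammer 1 n)"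
    unfolding V by (simp add: pochhammer_fact[symmetric] mult_ac)
  finally show ?thesis .
qed

text \<open>
  Expanding each power \<open>(1 - x)^(-b-k)\<close> on the right-hand side binomially gives a double series whose
  diagonals \<open>k + j = n\<close> are summed by Chu--Vandermonde. Its rearrangement requires absolute
  convergence: the series with absolute values is dominated by a hypergeometric series in
  \<open>\<bar>x\<bar> / (1 - \<bar>x\<bar>)\<close>, which is where the restriction \<open>\<bar>x\<bar> < 1/2\<close> comes from.
\<close>

lemma Pfaff:
  fixes a b c x :: complex
  assumes x: "norm x < 1/2" and c: "c \<notin> \<int>\<^sub>\<le>\<^sub>0"
  shows "hypergeo_F a b c x = (1 - x) powr (- b) * hypergeo_F (c - a) b c (x / (x - 1))"
proof -
  define u where "u k = pochhammer (c - a) k * pochhammer b k / (pochhammer c k * pochhammer 1 k)" for k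
  define f where "f = (\<lambda>(k, j). u k * (- x) ^ k * (pochhammer (b + of_nat k) j / fact j * x ^ j))"
  define r where "r = norm x"
  have r: "0 \<le> r" "r < 1/2"
    using x by (auto simp: r_def)
  have x1: "1 - x \<noteq> 0" "norm x < 1"
    using x by auto
  have quot: "norm (x / (x - 1)) < 1"
  proof -
    have "1 - r \<le> norm (x - 1)"
      using norm_triangle_ineq2[of 1 x] by (simp add: r_def norm_minus_commute)
    then show ?thesis
      using r x1 by (simp add: norm_divide r_def field_simps) 
  qed
  have pw: "(1 - x) powr (- (b + of_nat k)) = (1 - x) powr (- b) / (1 - x) ^ k" for k
  proof -
    have "(1 - x) powr (- (b + of_nat k)) = (1 - x) powr (- b - of_nat k)"
      by simp
    also have "\<dots> = (1 - x) powr (- b) / (1 - x) ^ k"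
      using x1 by (simp only: powr_diff powr_nat) simp
    finally show ?thesis .
  qed
  have rpw: "(1 - r) powr (- (norm b + real k)) = (1 - r) powr (- norm b) / (1 - r) ^ k" for k
  proof -
    have "(1 - r) powr (- (norm b + real k)) = (1 - r) powr (- norm b - real k)"
      by simp
    also have "\<dots> = (1 - r) powr (- norm b) / (1 - r) ^ k"
      using r by (simp only: powr_diff powr_realpow)
    finally show ?thesis .
  qed
  have abs_summable_f: "(\<lambda>p. norm (f p)) summable_on (UNIV \<times> UNIV)"
  proof (rule Infinite_Sum.abs_summable_on_comparison_test')
    define m where "m = (\<lambda>(k, j). norm (u k) * r ^ k * (pochhammer (norm b + real k) j / fact j * r ^ j))"
    define q where "q k = norm (u k) * r ^ k * (1 - r) powr (- (norm b + real k))" for k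
    have m_nonneg: "m (k, j) \<ge> 0" for k j
      using r by (auto simp: m_def pochhammer_prod intro!: mult_nonneg_nonneg divide_nonneg_nonneg prod_nonneg)
    show "norm (f p) \<le> m p" if "p \<in> UNIV \<times> UNIV" for p
    proof -
      obtain k j where p: "p = (k, j)" by force
      have "norm (b + of_nat k) \<le> norm b + real k"
        using norm_triangle_ineq[of b "of_nat k"] by simp
      then have "norm (pochhammer (b + of_nat k) j) \<le> pochhammer (norm b + real k) j"
        by (rule norm_pochhammer_le)
      then show ?thesis
        by (auto simp: p f_def m_def r_def norm_mult norm_divide norm_power
              intro!: mult_left_mono mult_right_mono divide_right_mono)
    qed
    show "m summable_on UNIV \<times> UNIV"
    proof (rule summable_on_SigmaI)
      show "((\<lambda>j. m (k, j)) has_sum q k) UNIV" for k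
      proof -
        have "(\<lambda>j. m (k, j)) sums q k"
          unfolding m_def q_def prod.case
          by (intro sums_mult neg_binomial_sums_real) (use r in auto)
        moreover have "m (k, j) \<ge> 0" for j
          by (rule m_nonneg)
        ultimately show ?thesis
          by (intro norm_summable_imp_has_sum) (auto simp: sums_iff)
      qed
      have "summable (\<lambda>k. (1 - r) powr (- norm b) * norm (u k * (of_real (r / (1 - r))) ^ k))"
        unfolding u_def
        by (intro summable_mult summable_norm_hypergeo_F) (use r in \<open>auto simp: norm_divide simp flip: of_real_diff\<close>)
      also have "(\<lambda>k. (1 - r) powr (- norm b) * norm (u k * (of_real (r / (1 - r))) ^ k)) = q"
      proof
        fix k
        have "norm (of_real (r / (1 - r)) :: complex) = r / (1 - r)"
          using r by (simp only: norm_of_real) simp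
        then show "(1 - r) powr (- norm b) * norm (u k * (of_real (r / (1 - r))) ^ k) = q k"
          unfolding q_def rpw norm_mult norm_power by (simp add: power_divide)
      qed
      finally show "q summable_on UNIV"
        using r by (intro norm_summable_imp_summable_on) (simp add: q_def abs_mult)
      show "m (k, j) \<ge> 0" for k j
        by (rule m_nonneg)
    qed
  qed
  then have "f summable_on (UNIV \<times> UNIV)"
    by (rule abs_summable_summable)
  then obtain S where S: "(f has_sum S) (UNIV \<times> UNIV)"
    by (auto simp: summable_on_def)
  have "(\<lambda>k. u k * (- x) ^ k * (1 - x) powr (- (b + of_nat k))) sums S"
  proof (rule has_sum_imp_sums, rule has_sum_SigmaD[OF S])
    fix k
    have "summable (\<lambda>j. norm (f (k, j)))"
    proof -
      have "summable (\<lambda>j. norm (u k * (- x) ^ k) * norm (pochhammer 1 j * pochhammer (b + of_nat k) j /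
              (pochhammer 1 j * pochhammer 1 j) * x ^ j))"
        by (intro summable_mult summable_norm_hypergeo_F x1)
      then show ?thesis
        by (simp add: f_def norm_mult norm_divide pochhammer_fact[symmetric])
    qed
    moreover have "(\<lambda>j. f (k, j)) sums (u k * (- x) ^ k * (1 - x) powr (- (b + of_nat k)))"
      unfolding f_def prod.case by (intro sums_mult neg_binomial_sums x1)
    ultimately show "((\<lambda>j. f (k, j)) has_sum (u k * (- x) ^ k * (1 - x) powr (- (b + of_nat k)))) UNIV"
      by (rule norm_summable_imp_has_sum)
  qed
  also have "(\<lambda>k. u k * (- x) ^ k * (1 - x) powr (- (b + of_nat k))) =
             (\<lambda>k. (1 - x) powr (- b) * (u k * (x / (x - 1)) ^ k))"
  proof
    fix k
    have "(- x) / (1 - x) = x / (x - 1)"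
      using minus_divide_divide[of x "x - 1"] by simp
    then have "(x / (x - 1)) ^ k = (- x) ^ k / (1 - x) ^ k"
      by (simp only: power_divide[symmetric])
    then show "u k * (- x) ^ k * (1 - x) powr (- (b + of_nat k)) = (1 - x) powr (- b) * (u k * (x / (x - 1)) ^ k)"
      unfolding pw by (simp only: times_divide_eq_right mult_ac)
  qed
  finally have "(\<lambda>k. (1 - x) powr (- b) * (u k * (x / (x - 1)) ^ k)) sums S" .
  moreover have "(\<lambda>k. (1 - x) powr (- b) * (u k * (x / (x - 1)) ^ k)) sums
                   ((1 - x) powr (- b) * hypergeo_F (c - a) b c (x / (x - 1)))"
    unfolding hypergeo_F_def u_def
    by (intro sums_mult summable_sums summable_hypergeo_F quot)
  ultimately have rhs: "S = (1 - x) powr (- b) * hypergeo_F (c - a) b c (x / (x - 1))"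
    by (rule sums_unique2)

  have "((\<lambda>(n, k). f (k, n - k)) has_sum S) (SIGMA n:UNIV. {..n})"
    using S by (subst has_sum_reindex_bij_witness
      [where i = "\<lambda>(k, j). (k + j, k)" and j = "\<lambda>(n, k). (k, n - k)" and T = "UNIV \<times> UNIV" and h = f and s' = S]) auto
  then have "(\<lambda>n. \<Sum>k\<le>n. f (k, n - k)) sums S"
    by (intro has_sum_imp_sums) (erule has_sum_SigmaD, auto intro: has_sum_finite)
  also have "(\<lambda>n. \<Sum>k\<le>n. f (k, n - k)) =
      (\<lambda>n. (pochhammer a n * pochhammer b n) / (pochhammer c n * pochhammer 1 n) * x ^ n)"
  proof
    fix n
    have "(\<Sum>k\<le>n. f (k, n - k)) =
        (\<Sum>k\<le>n. pochhammer (c - a) k * pochhammer b k / (pochhammer c k * pochhammer 1 k) * (- 1) ^ k *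
              (pochhammer (b + of_nat k) (n - k) / fact (n - k))) * x ^ n"
      unfolding sum_distrib_right
    proof (rule sum.cong)
      fix k assume "k \<in> {..n}"
      then have "x ^ n = x ^ k * x ^ (n - k)"
        by (simp flip: power_add)
      then show "f (k, n - k) = pochhammer (c - a) k * pochhammer b k / (pochhammer c k * pochhammer 1 k) * (- 1) ^ k *
              (pochhammer (b + of_nat k) (n - k) / fact (n - k)) * x ^ n"
        by (simp add: f_def u_def power_minus[of x])
    qed simp
    then show "(\<Sum>k\<le>n. f (k, n - k)) = (pochhammer a n * pochhammer b n) / (pochhammer c n * pochhammer 1 n) * x ^ n"
      by (simp only: Chu_Vandermonde_coeff[OF c])
  qed
  finally have "S = hypergeo_F a b c x"
    unfolding hypergeo_F_def by (rule sums_unique)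
  with rhs show ?thesis by simp
qed


section \<open>The recurrence in the parameter\<close>

lemma linear_quotient_tendsto:
  fixes a b c d :: complex
  assumes "d \<noteq> 0"
  shows "(\<lambda>n. (a + b * of_nat n) / (c + d * of_nat n)) \<longlonglongrightarrow> b / d"
proof -
  have "(\<lambda>n. (a / of_nat n + b) / (c / of_nat n + d)) \<longlonglongrightarrow> (0 + b) / (0 + d)"
    using assms by (intro tendsto_intros lim_const_over_n) auto
  moreover have "\<forall>\<^sub>F n in sequentially.
      (a / of_nat n + b) / (c / of_nat n + d) = (a + b * of_nat n) / (c + d * of_nat n)"
    using eventually_gt_at_top[of 0]
  proof eventually_elim
    case (elim n)
    have "(a / of_nat n + b) / (c / of_nat n + d) = ((a + b * of_nat n) / of_nat n) / ((c + d * of_nat n) / of_nat n)"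
      using elim by (simp add: add_divide_distrib)
    then show ?case
      using elim by simp
  qed
  ultimately show ?thesis
    by (simp add: tendsto_cong)
qed

text \<open>
  The summand of \<open>E(a)\<close> is named rather than its sum, because both the recurrence and the limit are
  obtained termwise.
\<close>

definition euler_term :: "complex \<Rightarrow> nat \<Rightarrow> complex" where
  "euler_term a n = pochhammer (1/2) n * pochhammer a n / (pochhammer (3/2 - 2 * a) n * pochhammer 1 n) * (1/4) ^ n"

lemma summable_euler_term: "summable (euler_term a)"
  using summable_hypergeo_F[of "1/4" "1/2" a "3/2 - 2 * a"] by (simp add: euler_term_def[abs_def])

text \<open>
  The right-hand side is what Gosper's method produces: one looks for an antidifference of the form
  \<open>p(m)\<close> times the common hypergeometric factor of the two terms, and comparing degrees leaves a linear
  polynomial \<open>p\<close>. That a solution exists reflects the special argument \<open>1/4\<close>. The antidifference is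
  written as a multiple of \<^term>\<open>euler_term a m\<close>, without the factor \<open>a + m\<close> in a denominator,
  so that terminating series, where \<open>a\<close> is a nonpositive integer, are covered as well.
\<close>

lemma euler_telescope:
  fixes a :: complex
  assumes "3/2 - 2 * a \<notin> \<int>\<^sub>\<le>\<^sub>0"
  defines "c \<equiv> 3/2 - 2 * a"
  shows "(\<Sum>n\<le>m. (5/4 - a) * (3/4 - a) * euler_term a n - (7/6 - a) * (5/6 - a) * euler_term (a - 1) n) =
         - (c * (c + 1) / 144) * ((1 + 2 * of_nat m) / (c + of_nat m)) *
            ((5 + 6 * of_nat m) / (c + 1 + of_nat m)) * euler_term a m"
proof -
  have nz: "c + of_nat i \<noteq> 0" for i
    using assms(1) by (auto simp: c_def[symmetric] add_eq_0_iff2)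
  show ?thesis
  proof (induction m)
    case 0
    have "c \<noteq> 0" "c + 1 \<noteq> 0"
      using nz[of 0] nz[of 1] by simp_all
    then show ?case
      by (simp add: euler_term_def) (simp add: c_def field_simps)
  next
    case (Suc m)
    define P where "P = euler_term a m"
    define x :: complex where "x = of_nat m"
    have n0: "c + x \<noteq> 0" "c + x + 1 \<noteq> 0" "c + x + 2 \<noteq> 0" "1 + x \<noteq> 0"  "c \<noteq> 0" "c + 1 \<noteq> 0"
      using nz[of m] nz[of "m+1"] nz[of "m+2"] nz[of 0] nz[of 1] of_nat_neq_0[of m, where ?'a = complex]
      by (simp_all add: x_def add_ac)
    have t1: "euler_term a (Suc m) = P * ((1/2 + x) * (a + x) / (4 * (c + x) * (1 + x)))"
      unfolding P_def euler_term_def c_def[symmetric]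
      by (simp add: x_def pochhammer_Suc mult_ac del: distrib_left_numeral)
    \<comment> \<open>Both ways of peeling factors off \<open>(c, m + 3)\<close> relate \<open>(c + 2, m + 1)\<close> to \<open>(c, m)\<close>.\<close>
    have "pochhammer c (Suc (Suc (Suc m))) = c * (c + 1) * pochhammer (c + 2) (Suc m)"
      by (simp only: pochhammer_rec[of c] pochhammer_rec[of "c + 1"]) (simp add: add.assoc)
    moreover have "pochhammer c (Suc (Suc (Suc m))) = pochhammer c m * ((c + x) * (c + x + 1) * (c + x + 2))"
      by (simp add: pochhammer_Suc x_def add_ac mult_ac)
    ultimately have "c * (c + 1) * pochhammer (c + 2) (Suc m) = pochhammer c m * ((c + x) * (c + x + 1) * (c + x + 2))"
      by (simp only:)
    then have p: "pochhammer (c + 2) (Suc m) = pochhammer c m * ((c + x) * (c + x + 1) * (c + x + 2)) / (c * (c + 1))"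
      using n0 by (simp add: nonzero_eq_divide_eq mult_ac)
    have q: "pochhammer (a - 1) (Suc m) = (a - 1) * pochhammer a m"
      by (simp add: pochhammer_rec)
    have r: "3/2 - 2 * (a - 1) = c + 2"
      by (simp add: c_def)
    have t2: "euler_term (a - 1) (Suc m) =
        P * ((1/2 + x) * (a - 1) * (c * (c + 1)) / (4 * (c + x) * (c + x + 1) * (c + x + 2) * (1 + x)))"
      unfolding P_def euler_term_def c_def[symmetric] r p q
      unfolding pochhammer_Suc[of _ m] power_Suc x_def[symmetric]
      by (simp only: times_divide_eq_left times_divide_eq_right divide_divide_eq_left divide_divide_eq_right
            mult_1_left mult_ac)
    have key: "- (c * (c + 1) / 144) * ((1 + 2 * x) / (c + x)) * ((5 + 6 * x) / (c + 1 + x)) +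
        ((5/4 - a) * (3/4 - a) * ((1/2 + x) * (a + x) / (4 * (c + x) * (1 + x)))
         - (7/6 - a) * (5/6 - a) * ((1/2 + x) * (a - 1) * (c * (c + 1)) / (4 * (c + x) * (c + x + 1) * (c + x + 2) * (1 + x)))) =
        - (c * (c + 1) / 144) * ((1 + 2 * (x + 1)) / (c + (x + 1))) *
            ((5 + 6 * (x + 1)) / (c + 1 + (x + 1))) * ((1/2 + x) * (a + x) / (4 * (c + x) * (1 + x)))"
    proof -
      \<comment> \<open>After clearing denominators and cancelling common factors, a polynomial identity in \<open>a\<close> and \<open>x\<close>.\<close>
      have core: "- 8 * (5 + 6 * x) * (c + x + 2) * (1 + x) + 36 * (a + x) * (c + x + 1) * (c + x + 2)
          - 144 * ((7/6 - a) * (5/6 - a)) * (a - 1) = - (3 + 2 * x) * (11 + 6 * x) * (a + x)"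
        by (simp add: c_def field_simps)
      \<comment> \<open>The denominators are abstracted to variables, so that they are not multiplied out.\<close>
      have clear: "- (e / 144) * (2 * s / D) * (u / D1) + (e / 4 * (s * t / (4 * D * y)) - R * (s * b * e / (4 * D * D1 * D2 * y))) =
          - (e / 144) * (v / D1) * (w / D2) * (s * t / (4 * D * y))"
        if nz: "D \<noteq> 0" "D1 \<noteq> 0" "D2 \<noteq> 0" "y \<noteq> 0"
          and eq: "- 8 * u * D2 * y + 36 * t * D1 * D2 - 144 * R * b = - v * w * t"
        for e s t u v w y D D1 D2 R b :: complex
      proof -
        have "- (e / 144) * (2 * s / D) * (u / D1) + (e / 4 * (s * t / (4 * D * y)) - R * (s * b * e / (4 * D * D1 * D2 * y))) -
            (- (e / 144) * (v / D1) * (w / D2) * (s * t / (4 * D * y))) =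
            e * s / (576 * D * D1 * D2 * y) * (- 8 * u * D2 * y + 36 * t * D1 * D2 - 144 * R * b + v * w * t)"
          using nz by (simp add: field_simps)
        also have "\<dots> = 0"
          unfolding eq by simp
        finally show ?thesis
          by (simp only: right_minus_eq)
      qed
      have d: "1 + 2 * x = 2 * (1/2 + x)" "c + 1 + x = c + x + 1" "c + (x + 1) = c + x + 1"
          "c + 1 + (x + 1) = c + x + 2" "1 + 2 * (x + 1) = 3 + 2 * x" "5 + 6 * (x + 1) = 11 + 6 * x"
          "(5/4 - a) * (3/4 - a) = c * (c + 1) / 4"
        by (simp_all add: c_def field_simps)
      show ?thesis
        unfolding d by (rule clear[OF n0(1-4) core])
    qed
    have scale: "K * P + (A * (P * u) - B * (P * v)) = L * (P * u)"
      if "K + (A * u - B * v) = L * u" for A B K L u v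
      using that by algebra
    have x1: "of_nat (Suc m) = x + 1"
      by (simp add: x_def)
    show ?case
      unfolding sum.atMost_Suc Suc t1 t2 x1 P_def[symmetric] x_def[symmetric]
      by (rule scale[OF key])
  qed
qed

lemma euler_recurrence:
  fixes a :: complex
  assumes c: "3/2 - 2 * a \<notin> \<int>\<^sub>\<le>\<^sub>0"
  shows "(5/4 - a) * (3/4 - a) * suminf (euler_term a) = (7/6 - a) * (5/6 - a) * suminf (euler_term (a - 1))"
proof -
  define d where "d n = (5/4 - a) * (3/4 - a) * euler_term a n - (7/6 - a) * (5/6 - a) * euler_term (a - 1) n" for n
  have "d sums ((5/4 - a) * (3/4 - a) * suminf (euler_term a) - (7/6 - a) * (5/6 - a) * suminf (euler_term (a - 1)))"
    unfolding d_def by (intro sums_diff sums_mult summable_sums summable_euler_term)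
  moreover have "d sums 0"
    unfolding sums_def_le d_def euler_telescope[OF c]
  proof -
    let ?c = "3/2 - 2 * a"
    have "euler_term a \<longlonglongrightarrow> 0"
      by (rule summable_LIMSEQ_zero[OF summable_euler_term])
    then have "(\<lambda>m. - (?c * (?c + 1) / 144) * ((1 + 2 * of_nat m) / (?c + 1 * of_nat m)) *
            ((5 + 6 * of_nat m) / (?c + 1 + 1 * of_nat m)) * euler_term a m)
        \<longlonglongrightarrow> - (?c * (?c + 1) / 144) * (2 / 1) * (6 / 1) * 0"
      by (intro tendsto_mult tendsto_const linear_quotient_tendsto) auto
    then show "(\<lambda>m. - (?c * (?c + 1) / 144) * ((1 + 2 * of_nat m) / (?c + of_nat m)) *
            ((5 + 6 * of_nat m) / (?c + 1 + of_nat m)) * euler_term a m) \<longlonglongrightarrow> 0"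
      by simp
  qed
  ultimately have "(5/4 - a) * (3/4 - a) * suminf (euler_term a) - (7/6 - a) * (5/6 - a) * suminf (euler_term (a - 1)) = 0"
    by (rule sums_unique2)
  then show ?thesis by simp
qed

lemma euler_shift:
  fixes a :: complex
  assumes c: "3/2 - 2 * a \<notin> \<int>\<^sub>\<le>\<^sub>0"
  shows "pochhammer (5/4 - a) N * pochhammer (3/4 - a) N * suminf (euler_term a) =
         pochhammer (7/6 - a) N * pochhammer (5/6 - a) N * suminf (euler_term (a - of_nat N))"
proof (induction N)
  case (Suc N)
  define b where "b = a - of_nat N"
  have "3/2 - 2 * b \<notin> \<int>\<^sub>\<le>\<^sub>0"
  proof
    assume "3/2 - 2 * b \<in> \<int>\<^sub>\<le>\<^sub>0"
    then have "3/2 - 2 * b - of_nat (2 * N) \<in> \<int>\<^sub>\<le>\<^sub>0"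
      by (rule nonpos_Ints_diff_Nats) simp
    then show False
      using c by (simp add: b_def algebra_simps)
  qed
  note rec = euler_recurrence[OF this]
  have step: "pochhammer (z - a) (Suc N) = pochhammer (z - a) N * (z - b)" for z
    by (simp add: pochhammer_Suc b_def)
  have shift: "a - of_nat (Suc N) = b - 1"
    by (simp add: b_def)
  have "pochhammer (5/4 - a) (Suc N) * pochhammer (3/4 - a) (Suc N) * suminf (euler_term a) =
      (5/4 - b) * (3/4 - b) * (pochhammer (5/4 - a) N * pochhammer (3/4 - a) N * suminf (euler_term a))"
    by (simp only: step mult_ac)
  also have "\<dots> = pochhammer (7/6 - a) N * pochhammer (5/6 - a) N * ((5/4 - b) * (3/4 - b) * suminf (euler_term b))"
    unfolding Suc b_def[symmetric] by (simp only: mult_ac)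
  also have "\<dots> = pochhammer (7/6 - a) (Suc N) * pochhammer (5/6 - a) (Suc N) * suminf (euler_term (a - of_nat (Suc N)))"
    unfolding rec shift step by (simp only: mult_ac)
  finally show ?case .
qed simp

section \<open>The limit of the iterated recurrence\<close>

text \<open>
  By Tannery's theorem the limit may be taken termwise. For large \<open>N\<close>, the quotient
  \<open>(a - N, k) / (3/2 - 2a + 2N, k)\<close> is a product of \<open>k\<close> quotients of absolute value at most \<open>2\<close>, which
  together with the factor \<open>(1/4)^k\<close> gives the summable majorant \<open>(1/2)^k\<close>.
\<close>

lemma euler_limit:
  "(\<lambda>N. suminf (euler_term (a - of_nat N))) \<longlonglongrightarrow> (9/8) powr (- 1/2)"
proof -
  define \<beta> where "\<beta> = 3/2 - 2 * a"
  define N0 where "N0 = nat \<lceil>norm a + 2 * norm \<beta>\<rceil>"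
  have quot: "euler_term (a - of_nat N) k = pochhammer (1/2) k / fact k *
      (\<Prod>i<k. (a + of_nat i + (- 1) * of_nat N) / (\<beta> + of_nat i + 2 * of_nat N)) * (1/4) ^ k" for N k
  proof -
    have num: "pochhammer (a - of_nat N) k = (\<Prod>i<k. a + of_nat i + (- 1) * of_nat N)"
      by (simp add: pochhammer_prod atLeast0LessThan algebra_simps)
    have den: "pochhammer (3/2 - 2 * (a - of_nat N)) k = (\<Prod>i<k. \<beta> + of_nat i + 2 * of_nat N)"
      by (simp add: pochhammer_prod atLeast0LessThan \<beta>_def algebra_simps)
    show ?thesis
      unfolding euler_term_def num den prod_dividef by (simp add: pochhammer_fact[symmetric] mult_ac)
  qed
  have "(\<lambda>N. suminf (euler_term (a - of_nat N))) \<longlonglongrightarrow>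
          (\<Sum>k. pochhammer (1/2) k / fact k * (\<Prod>i<k. (- 1) / 2) * (1/4) ^ k)"
  proof (rule tannerys_theorem[THEN conjunct2, THEN conjunct2])
    show "(\<lambda>N. euler_term (a - of_nat N) k) \<longlonglongrightarrow> pochhammer (1/2) k / fact k * (\<Prod>i<k. (- 1) / 2) * (1/4) ^ k" for k
      unfolding quot by (intro tendsto_mult tendsto_const tendsto_prod linear_quotient_tendsto) auto
    have bound: "norm (euler_term (a - of_nat N) k) \<le> (1/2) ^ k" if "N \<ge> N0" for N k
    proof -
      have N: "norm a + 2 * norm \<beta> \<le> real N"
        using that unfolding N0_def by linarith
      have "norm ((a + of_nat i + (- 1) * of_nat N) / (\<beta> + of_nat i + 2 * of_nat N)) \<le> 2" for i
      proof -
        have "norm (a + of_nat i + (- 1) * of_nat N) \<le> norm a + real i + real N"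
          using norm_triangle_ineq[of a "of_nat i"] norm_triangle_ineq4[of "a + of_nat i" "of_nat N"] by simp
        moreover have "norm (\<beta> + of_nat i + 2 * of_nat N) \<ge> real i + 2 * real N - norm \<beta>"
          using norm_diff_ineq[of "of_nat (i + 2 * N)" \<beta>] unfolding norm_of_nat by (simp add: add_ac)
        ultimately have "norm (a + of_nat i + (- 1) * of_nat N) \<le> 2 * norm (\<beta> + of_nat i + 2 * of_nat N)"
          using N by linarith
        then show ?thesis
          by (auto simp: norm_divide divide_le_eq)
      qed
      then have "norm (\<Prod>i<k. (a + of_nat i + (- 1) * of_nat N) / (\<beta> + of_nat i + 2 * of_nat N)) \<le> (\<Prod>i<k. 2)"
        unfolding prod_norm[symmetric] by (intro prod_mono conjI norm_ge_zero)
      moreover have "norm (pochhammer (1/2 :: complex) k / fact k) \<le> 1"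
        using norm_pochhammer_le[of "1/2" 1 k] by (simp add: norm_divide pochhammer_fact[symmetric])
      ultimately have "norm (euler_term (a - of_nat N) k) \<le> 1 * (\<Prod>i<k. 2) * (1/4) ^ k"
        unfolding quot norm_mult by (intro mult_mono) (auto simp: norm_power norm_divide)
      also have "\<dots> = (1/2) ^ k"
        by (simp flip: power_mult_distrib)
      finally show ?thesis .
    qed
    have "\<forall>\<^sub>F (k, N) in sequentially \<times>\<^sub>F sequentially. N \<ge> N0"
      using eventually_prodI[OF always_eventually[of "\<lambda>_. True"] eventually_ge_at_top[of N0]]
      by (simp add: case_prod_unfold)
    then show "\<forall>\<^sub>F (k, N) in sequentially \<times>\<^sub>F sequentially. norm (euler_term (a - of_nat N) k) \<le> (1/2) ^ k"
      by eventually_elim (use bound in auto)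
    show "summable (\<lambda>k. (1/2 :: real) ^ k)"
      by simp
  qed simp
  moreover have "(\<lambda>k. pochhammer (1/2) k / fact k * (\<Prod>i<k. (- 1) / 2) * (1/4) ^ k) sums ((9/8 :: complex) powr (- 1/2))"
  proof -
    have "(\<lambda>k. pochhammer (1/2) k / fact k * (- 1/8) ^ k) sums ((1 - (- 1/8) :: complex) powr (- (1/2)))"
      by (rule neg_binomial_sums) (simp add: norm_divide)
    moreover have "(- 1/8 :: complex) ^ k = (\<Prod>i<k. (- 1) / 2) * (1/4) ^ k" for k
      by (simp flip: power_mult_distrib)
    ultimately show ?thesis
      by (simp add: mult.assoc)
  qed
  ultimately show ?thesis
    by (simp add: sums_iff)
qed

text \<open>
  In Euler's limit for \<open>rGamma\<close> the symbol \<open>(z, n + 1)\<close> is normalised by \<open>n! n^z\<close>. The balancing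
  condition \<open>p + q = r + s\<close> makes these normalisations cancel.
\<close>

lemma pochhammer_quotient_tendsto:
  fixes p q r s :: complex
  assumes "p + q = r + s" "r \<notin> \<int>\<^sub>\<le>\<^sub>0" "s \<notin> \<int>\<^sub>\<le>\<^sub>0"
  shows "(\<lambda>n. pochhammer p (Suc n) * pochhammer q (Suc n) / (pochhammer r (Suc n) * pochhammer s (Suc n)))
           \<longlonglongrightarrow> rGamma p * rGamma q * (Gamma r * Gamma s)"
proof -
  have "(\<lambda>n. rGamma_series p n * rGamma_series q n / (rGamma_series r n * rGamma_series s n))
           \<longlonglongrightarrow> rGamma p * rGamma q / (rGamma r * rGamma s)"
    using assms by (intro tendsto_intros) (auto simp: rGamma_eq_zero_iff)
  also have "(\<lambda>n. rGamma_series p n * rGamma_series q n / (rGamma_series r n * rGamma_series s n)) =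
     (\<lambda>n. pochhammer p (Suc n) * pochhammer q (Suc n) / (pochhammer r (Suc n) * pochhammer s (Suc n)))"
  proof
    fix n
    define L where "L = complex_of_real (ln (real n))"
    have e: "exp (p * L) * exp (q * L) = exp (r * L) * exp (s * L)"
      using assms(1) by (simp flip: exp_add distrib_right)
    have "rGamma_series p n * rGamma_series q n / (rGamma_series r n * rGamma_series s n) =
     pochhammer p (Suc n) * pochhammer q (Suc n) / (pochhammer r (Suc n) * pochhammer s (Suc n)) *
       ((exp (r * L) * exp (s * L)) / (exp (p * L) * exp (q * L)))"
      unfolding rGamma_series_def L_def by (simp add: mult_ac)
    then show "rGamma_series p n * rGamma_series q n / (rGamma_series r n * rGamma_series s n) =
     pochhammer p (Suc n) * pochhammer q (Suc n) / (pochhammer r (Suc n) * pochhammer s (Suc n))"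
      unfolding e by simp
  qed
  also have "rGamma p * rGamma q / (rGamma r * rGamma s) = rGamma p * rGamma q * (Gamma r * Gamma s)"
    by (simp add: rGamma_inverse_Gamma divide_inverse)
  finally show ?thesis .
qed

section \<open>The evaluation\<close>

lemma euler_value:
  fixes a :: complex
  assumes c: "3/2 - 2 * a \<notin> \<int>\<^sub>\<le>\<^sub>0"
  shows "suminf (euler_term a) = (9/8) powr (- 1/2) *
           (rGamma (7/6 - a) * rGamma (5/6 - a) * (Gamma (5/4 - a) * Gamma (3/4 - a)))"
proof -
  have nonpole: "5/4 - a \<notin> \<int>\<^sub>\<le>\<^sub>0" "3/4 - a \<notin> \<int>\<^sub>\<le>\<^sub>0"
  proof -
    show "3/4 - a \<notin> \<int>\<^sub>\<le>\<^sub>0"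
    proof
      assume "3/4 - a \<in> \<int>\<^sub>\<le>\<^sub>0"
      then obtain n where "3/4 - a = - of_nat n"
        by (elim nonpos_Ints_cases')
      moreover have "3/2 - 2 * a = 2 * (3/4 - a)"
        by (simp add: algebra_simps)
      ultimately have "3/2 - 2 * a = - of_nat (2 * n)"
        by simp
      with c show False
        by (metis minus_of_nat_in_nonpos_Ints)
    qed
    show "5/4 - a \<notin> \<int>\<^sub>\<le>\<^sub>0"
    proof
      assume "5/4 - a \<in> \<int>\<^sub>\<le>\<^sub>0"
      then obtain n where "5/4 - a = - of_nat n"
        by (elim nonpos_Ints_cases')
      moreover have "3/2 - 2 * a = 2 * (5/4 - a) - 1"
        by (simp add: algebra_simps)
      ultimately have "3/2 - 2 * a = - of_nat (2 * n + 1)"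
        by simp
      with c show False
        by (metis minus_of_nat_in_nonpos_Ints)
    qed
  qed
  have "(\<lambda>n. suminf (euler_term (a - of_nat (Suc n))) *
      (pochhammer (7/6 - a) (Suc n) * pochhammer (5/6 - a) (Suc n) /
        (pochhammer (5/4 - a) (Suc n) * pochhammer (3/4 - a) (Suc n)))) \<longlonglongrightarrow>
      (9/8) powr (- 1/2) * (rGamma (7/6 - a) * rGamma (5/6 - a) * (Gamma (5/4 - a) * Gamma (3/4 - a)))"
    by (intro tendsto_mult pochhammer_quotient_tendsto nonpole LIMSEQ_Suc[OF euler_limit]) simp
  moreover have "suminf (euler_term (a - of_nat N)) *
      (pochhammer (7/6 - a) N * pochhammer (5/6 - a) N /
        (pochhammer (5/4 - a) N * pochhammer (3/4 - a) N)) = suminf (euler_term a)" for N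
    using euler_shift[OF c, of N] pochhammer_neq_0[OF nonpole(1), of N] pochhammer_neq_0[OF nonpole(2), of N]
    by (simp add: field_simps)
  ultimately have "(\<lambda>n. suminf (euler_term a)) \<longlonglongrightarrow>
      (9/8) powr (- 1/2) * (rGamma (7/6 - a) * rGamma (5/6 - a) * (Gamma (5/4 - a) * Gamma (3/4 - a)))"
    by (simp only:)
  then show ?thesis
    by (simp only: LIMSEQ_const_iff)
qed

theorem mainTheorem8:
  fixes a :: complex
  assumes "3/2 - 2 * a \<notin> \<int>\<^sub>\<le>\<^sub>0"
  shows "hypergeo_F (1 - 2 * a) (3/2 - 3 * a) (3/2 - 2 * a) (1/4) =
           (2 powr (7/2 - 6 * a) * Gamma (5/4 - a) * Gamma (3/4 - a)) / 3 powr (2 - 3 * a)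
             * rGamma (7/6 - a) * rGamma (5/6 - a)"
proof -
  define c where "c = 3/2 - 2 * a"
  have sym: "hypergeo_F p q r x = hypergeo_F q p r x" for p q r x
    by (simp add: hypergeo_F_def mult.commute)
  have "hypergeo_F (1 - 2 * a) (3/2 - 3 * a) c (1/4) =
          (3/4) powr (3 * a - 3/2) * hypergeo_F (1/2) (3/2 - 3 * a) c (- 1/3)"
    using Pfaff[of "1/4" c "1 - 2 * a" "3/2 - 3 * a"] assms by (simp add: c_def norm_divide)
  also have "hypergeo_F (1/2) (3/2 - 3 * a) c (- 1/3) = hypergeo_F (3/2 - 3 * a) (1/2) c (- 1/3)"
    by (rule sym)
  also have "\<dots> = (4/3) powr (- 1/2) * hypergeo_F a (1/2) c (1/4)"
    using Pfaff[of "- 1/3" c "3/2 - 3 * a" "1/2"] assms by (simp add: c_def norm_divide)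
  also have "hypergeo_F a (1/2) c (1/4) = suminf (euler_term a)"
    by (simp add: hypergeo_F_def euler_term_def[abs_def] c_def mult.commute)
  also have "(3/4 :: complex) powr (3 * a - 3/2) * ((4/3) powr (- 1/2) * suminf (euler_term a)) =
     ((3/4) powr (3 * a - 3/2) * (4/3) powr (- 1/2) * (9/8) powr (- 1/2)) *
           (rGamma (7/6 - a) * rGamma (5/6 - a) * (Gamma (5/4 - a) * Gamma (3/4 - a)))"
    by (simp add: euler_value[OF assms])
  also have "(3/4 :: complex) powr (3 * a - 3/2) * (4/3) powr (- 1/2) * (9/8) powr (- 1/2) =
     2 powr (7/2 - 6 * a) / 3 powr (2 - 3 * a)"
  proof -
    define l2 l3 where "l2 = complex_of_real (ln 2)" and "l3 = complex_of_real (ln 3)"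
    have pw: "complex_of_real y powr z = exp (z * complex_of_real (ln y))" if "y > 0" for y z
      using that by (simp add: powr_def Ln_of_real)
    have ln4: "ln (4 :: real) = 2 * ln 2" and ln8: "ln (8 :: real) = 3 * ln 2" and ln9: "ln (9 :: real) = 2 * ln 3"
      using ln_realpow[of 2 2] ln_realpow[of 2 3] ln_realpow[of 3 2] by simp_all
    have "(3/4 :: complex) powr z = exp (z * (l3 - 2 * l2))" for z
      using pw[of "3/4" z] by (simp add: ln_div ln4 l2_def l3_def)
    moreover have "(4/3 :: complex) powr z = exp (z * (2 * l2 - l3))" for z
      using pw[of "4/3" z] by (simp add: ln_div ln4 l2_def l3_def)
    moreover have "(9/8 :: complex) powr z = exp (z * (2 * l3 - 3 * l2))" for z
      using pw[of "9/8" z] by (simp add: ln_div ln8 ln9 l2_def l3_def)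
    moreover have "(2 :: complex) powr z = exp (z * l2)" "(3 :: complex) powr z = exp (z * l3)" for z
      using pw[of 2 z] pw[of 3 z] by (simp_all add: l2_def l3_def)
    moreover have "(3 * a - 3/2) * (l3 - 2 * l2) + (- 1/2) * (2 * l2 - l3) + (- 1/2) * (2 * l3 - 3 * l2) =
        (7/2 - 6 * a) * l2 - (2 - 3 * a) * l3"
      by (simp add: field_simps)
    ultimately show ?thesis
      by (simp only: exp_add[symmetric] exp_diff[symmetric])
  qed
  finally show ?thesis
    by (simp add: c_def mult_ac)
qed

end
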